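(* Let $r\geqslant 3$ be a fixed integer. The threshold probability for the property that the final graph generated by the random $r$-generalized triadic process, after deleting the vertices $v_1,\dots,v_{r-2}$, is connected is $n^{-1}\log n$.
   Context: For a fixed integer $r\geqslant 3$, $\mathbb{H}_r(n,p)$ is the random $r$-uniform hypergraph on vertex set $[n]$ in which each $r$-subset is a hyperedge independently with probability $p$. The random $r$-generalized triadic process starts with the complete bipartite graph $K_{r-2,n-r+2}$ on $[n]$ with parts $\{v_1,\dots,v_{r-2}\}$ and $[n]\setminus\{v_1,\dots,v_{r-2}\}$. It repeatedly chooses two distinct vertices $x,y$ uniformly at random and adds $\{x,y\}$ as an edge if there is a set $Z=\{z_1,\dots,z_{r-2}\}\subseteq[n]\setminus\{x,y\}$ such that $\{x,z_i\}$ and $\{y,z_i\}$ are edges of the current graph for all $i$ and $\{x,y,z_1,\dots,z_{r-2}\}$ is a hyperedge of $\mathbb{H}_r(n,p)$; it continues until no further pair can be added. The threshold probability for the property is meant in the standard sense for $\mathbb{G}(n,p)$ connectivity: the property is as in the Erdős–Rényi random graph with threshold $n^{-1}\log n$ (it holds with high probability when $p$ is asymptotically above this threshold and fails with high probability when below). Asymptotics are as $n\to\infty$. *)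

theory Defs
  imports "HOL-Probability.Probability"
begin

text \<open>Hypergraphs and simple graphs on \<open>{1..n}\<close> are represented by their sets of (hyper)edges;
  a graph edge is a two-element set.\<close>

definition uniform_edges :: "nat \<Rightarrow> nat \<Rightarrow> nat set set" where
  "uniform_edges r n = {e. e \<subseteq> {1..n} \<and> card e = r}"

definition random_hypergraph :: "nat \<Rightarrow> nat \<Rightarrow> real \<Rightarrow> nat set set pmf" where
  "random_hypergraph r n p =
     map_pmf (\<lambda>f. {e \<in> uniform_edges r n. f e})
       (Pi_pmf (uniform_edges r n) False (\<lambda>_. bernoulli_pmf p))"

definition random_pair :: "nat \<Rightarrow> (nat \<times> nat) pmf" where
  "random_pair n = pmf_of_set {(x, y). x \<in> {1..n} \<and> y \<in> {1..n} \<and> x \<noteq> y}"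

definition complete_bipartite :: "nat set \<Rightarrow> nat set \<Rightarrow> nat set set" where
  "complete_bipartite A B = {{a, b} | a b. a \<in> A \<and> b \<in> B}"

definition addable :: "nat \<Rightarrow> nat \<Rightarrow> nat set set \<Rightarrow> nat set set \<Rightarrow> nat \<Rightarrow> nat \<Rightarrow> bool" where
  "addable r n H G x y \<longleftrightarrow>
     (\<exists>Z. Z \<subseteq> {1..n} - {x, y} \<and> card Z = r - 2 \<and>
          (\<forall>z\<in>Z. {x, z} \<in> G \<and> {y, z} \<in> G) \<and> {x, y} \<union> Z \<in> H)"

text \<open>The set \<open>V\<close> is \<open>{v\<^sub>1, \<dots>, v\<^bsub>r-2\<^esub>}\<close>, and \<open>s\<close> is the sequence of chosen pairs.\<close>

primrec triadic_graph ::
  "nat \<Rightarrow> nat \<Rightarrow> nat set \<Rightarrow> nat set set \<Rightarrow> (nat \<times> nat) stream \<Rightarrow> nat \<Rightarrow> nat set set" where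
  "triadic_graph r n V H s 0 = complete_bipartite V ({1..n} - V)"
| "triadic_graph r n V H s (Suc t) =
     (let G = triadic_graph r n V H s t; (x, y) = s !! t
      in if addable r n H G x y then insert {x, y} G else G)"

definition saturated :: "nat \<Rightarrow> nat \<Rightarrow> nat set set \<Rightarrow> nat set set \<Rightarrow> bool" where
  "saturated r n H G \<longleftrightarrow>
     (\<forall>x\<in>{1..n}. \<forall>y\<in>{1..n}. x \<noteq> y \<and> addable r n H G x y \<longrightarrow> {x, y} \<in> G)"

text \<open>The process terminates almost surely; on the null set where it does not,
  the value of the following is irrelevant.\<close>

definition final_graph ::
  "nat \<Rightarrow> nat \<Rightarrow> nat set \<Rightarrow> nat set set \<Rightarrow> (nat \<times> nat) stream \<Rightarrow> nat set set" where
  "final_graph r n V H s =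
     triadic_graph r n V H s (LEAST t. saturated r n H (triadic_graph r n V H s t))"

definition triadic_space ::
  "nat \<Rightarrow> nat \<Rightarrow> real \<Rightarrow> (nat set set \<times> (nat \<times> nat) stream) measure" where
  "triadic_space r n p =
     measure_pmf (random_hypergraph r n p) \<Otimes>\<^sub>M stream_space (measure_pmf (random_pair n))"

text \<open>Connectedness of the subgraph of \<open>G\<close> induced on \<open>W\<close>.\<close>

definition connected_on :: "nat set \<Rightarrow> nat set set \<Rightarrow> bool" where
  "connected_on W G \<longleftrightarrow>
     (\<forall>x\<in>W. \<forall>y\<in>W. (x, y) \<in> {(a, b). a \<in> W \<and> b \<in> W \<and> {a, b} \<in> G}\<^sup>*)"

definition prob_final_connected :: "nat \<Rightarrow> nat \<Rightarrow> nat set \<Rightarrow> real \<Rightarrow> real" where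
  "prob_final_connected r n V p =
     measure (triadic_space r n p)
       {(H, s) \<in> space (triadic_space r n p).
          connected_on ({1..n} - V) (final_graph r n V H s)}"

text \<open>The threshold notion of the Erdos-Renyi connectivity theorem (a sharp threshold); in
  particular the probability tends to 1 if \<open>p n / th n\<close> tends to infinity and to 0 if
  \<open>p n / th n\<close> tends to 0. Here \<open>P n q\<close> is the probability of the property for parameters
  \<open>n\<close> and \<open>q\<close>.\<close>

definition is_threshold :: "(nat \<Rightarrow> real \<Rightarrow> real) \<Rightarrow> (nat \<Rightarrow> real) \<Rightarrow> bool" where
  "is_threshold P th \<longleftrightarrow>
     (\<forall>p. (\<forall>n. 0 \<le> p n \<and> p n \<le> 1) \<longrightarrow>
       (\<forall>\<epsilon>>0.
          ((\<forall>\<^sub>F n in sequentially. p n \<ge> (1 + \<epsilon>) * th n) \<longrightarrow>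
             (\<lambda>n. P n (p n)) \<longlonglongrightarrow> 1) \<and>
          ((\<forall>\<^sub>F n in sequentially. p n \<le> (1 - \<epsilon>) * th n) \<longrightarrow>
             (\<lambda>n. P n (p n)) \<longlonglongrightarrow> 0)))"

end

theory Submission
  imports Defs "HOL-Real_Asymp.Real_Asymp"
begin

text \<open>Put \<open>W = {1..n} - V\<close>. With \<open>Z = V\<close> the process adds every pair \<open>e\<close> in \<open>W\<close> such that \<open>e \<union> V\<close> is a
  hyperedge, so the final graph contains the link graph of \<open>V\<close>, which is distributed as the
  Erdos-Renyi graph on \<open>W\<close>. Conversely a cut of \<open>W\<close> that the link graph does not cross is never crossed:
  the endpoints of a first crossing edge would have common neighbours in \<open>V\<close> only. Hence the final
  graph is almost surely connected on \<open>W\<close> exactly if the link graph is. Above the threshold the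
  link graph is connected by a union bound over cuts; below it, the second moment method gives an
  isolated vertex.\<close>

subsection \<open>The final graph and the link graph\<close>

text \<open>If \<open>y\<close> is unreachable from \<open>x\<close>, the vertices reachable from
  \<open>x\<close> form an uncrossed cut. Comparing the final graph with the link graph cut by cut
  avoids comparing their edge sets, which may differ.\<close>

lemma connected_on_iff_cut:
  "connected_on W G \<longleftrightarrow> (\<forall>S\<subseteq>W. S \<noteq> {} \<longrightarrow> S \<noteq> W \<longrightarrow> (\<exists>a\<in>S. \<exists>b\<in>W - S. {a, b} \<in> G))"
proof
  assume conn: "connected_on W G"
  show "\<forall>S\<subseteq>W. S \<noteq> {} \<longrightarrow> S \<noteq> W \<longrightarrow> (\<exists>a\<in>S. \<exists>b\<in>W - S. {a, b} \<in> G)"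
  proof (intro allI impI, rule ccontr)
    fix S assume S: "S \<subseteq> W" "S \<noteq> {}" "S \<noteq> W"
      and no: "\<not> (\<exists>a\<in>S. \<exists>b\<in>W - S. {a, b} \<in> G)"
    then obtain x y where x: "x \<in> S" and y: "y \<in> W" "y \<notin> S" by blast
    have "(x, y) \<in> {(a, b). a \<in> W \<and> b \<in> W \<and> {a, b} \<in> G}\<^sup>*"
      using conn x y S unfolding connected_on_def by blast
    then have "y \<in> S"
      using x by (induction rule: rtrancl_induct) (use no in blast)+
    with y show False by simp
  qed
next
  assume cut: "\<forall>S\<subseteq>W. S \<noteq> {} \<longrightarrow> S \<noteq> W \<longrightarrow> (\<exists>a\<in>S. \<exists>b\<in>W - S. {a, b} \<in> G)"
  define E where "E = {(a, b). a \<in> W \<and> b \<in> W \<and> {a, b} \<in> G}"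
  have "(x, y) \<in> E\<^sup>*" if "x \<in> W" "y \<in> W" for x y
  proof (rule ccontr)
    assume nc: "(x, y) \<notin> E\<^sup>*"
    define S where "S = {z \<in> W. (x, z) \<in> E\<^sup>*}"
    have "S \<subseteq> W" "S \<noteq> {}" "S \<noteq> W" using that nc unfolding S_def by auto
    then obtain a b where ab: "a \<in> S" "b \<in> W - S" "{a, b} \<in> G" using cut by meson
    then have "(a, b) \<in> E" unfolding E_def S_def by auto
    with ab have "b \<in> S" unfolding S_def by (auto intro: rtrancl_into_rtrancl)
    with ab show False by simp
  qed
  then show "connected_on W G" unfolding connected_on_def E_def by blast
qed

text \<open>On pairs inside \<open>{1..n} - V\<close> this is the usual link graph of
  \<open>V\<close>; only such pairs matter for \<open>connected_on\<close>.\<close>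

definition link :: "nat set \<Rightarrow> nat set set \<Rightarrow> nat set set" where
  "link V H = {e. e \<union> V \<in> H}"

lemma addable_mono: "addable r n H G x y \<Longrightarrow> G \<subseteq> G' \<Longrightarrow> addable r n H G' x y"
  unfolding addable_def by blast

lemma triadic_graph_mono:
  "t \<le> t' \<Longrightarrow> triadic_graph r n V H s t \<subseteq> triadic_graph r n V H s t'"
  by (rule lift_Suc_mono_le) (auto simp: Let_def split: prod.splits)

lemma triadic_graph_cong:
  "(\<And>i. i < t \<Longrightarrow> s !! i = s' !! i) \<Longrightarrow> triadic_graph r n V H s t = triadic_graph r n V H s' t"
  by (induction t) auto

text \<open>Induction over time. Let a crossing pair \<open>a\<close>, \<open>b\<close> have a
  common neighbour \<open>z\<close>: were \<open>z\<close> in \<open>S\<close>, then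
  \<open>{z, b}\<close> would already cross, and were it on the other side, \<open>{a, z}\<close>
  would. So all of \<open>Z\<close> lies in \<open>V\<close>, hence \<open>Z = V\<close> by
  cardinality, and the hyperedge used puts \<open>{a, b}\<close> into the link graph.\<close>

lemma triadic_graph_cut:
  assumes V: "finite V" "card V = r - 2"
    and S: "S \<subseteq> {1..n} - V"
    and no: "\<And>a b. a \<in> S \<Longrightarrow> b \<in> {1..n} - V - S \<Longrightarrow> {a, b} \<notin> link V H"
    and ab: "a \<in> S" "b \<in> {1..n} - V - S"
  shows "{a, b} \<notin> triadic_graph r n V H s t"
  using ab
proof (induction t arbitrary: a b)
  case 0
  then show ?case using S by (auto simp: complete_bipartite_def doubleton_eq_iff)
next
  case (Suc t)
  define G where "G = triadic_graph r n V H s t"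
  obtain x y where xy: "s !! t = (x, y)" by fastforce
  have IH: "{c, d} \<notin> G" "{d, c} \<notin> G" if "c \<in> S" "d \<in> {1..n} - V - S" for c d
    using Suc.IH[OF that] by (simp_all add: G_def insert_commute)
  have "\<not> addable r n H G x y" if eq: "{a, b} = {x, y}"
  proof
    assume "addable r n H G x y"
    then obtain Z where Z: "Z \<subseteq> {1..n}" "card Z = r - 2"
      and adj: "\<And>z. z \<in> Z \<Longrightarrow> {x, z} \<in> G \<and> {y, z} \<in> G" and H: "{x, y} \<union> Z \<in> H"
      unfolding addable_def by blast
    have adj': "{a, z} \<in> G \<and> {b, z} \<in> G" if "z \<in> Z" for z
      using adj[OF that] eq by (auto simp: doubleton_eq_iff)
    have "Z \<subseteq> V"
    proof
      fix z assume "z \<in> Z"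
      with adj'[OF this] IH[of a z] IH[of z b] Suc.prems Z show "z \<in> V" by blast
    qed
    then have "Z = V" using V Z by (intro card_subset_eq) auto
    with H eq no[OF Suc.prems] show False by (simp add: link_def)
  qed
  then show ?case using Suc.IH[OF Suc.prems]
    by (auto simp: Let_def xy G_def)
qed

text \<open>The initial bipartite graph joins \<open>a\<close> and \<open>b\<close> to all of
  \<open>V\<close>, so \<open>Z = V\<close> makes the pair addable.\<close>

lemma saturated_imp_link_subset:
  assumes "saturated r n H G" "V \<subseteq> {1..n}" "card V = r - 2"
    and "complete_bipartite V ({1..n} - V) \<subseteq> G"
    and "a \<in> {1..n} - V" "b \<in> {1..n} - V" "a \<noteq> b" "{a, b} \<in> link V H"
  shows "{a, b} \<in> G"
proof -
  have "{a, v} \<in> G \<and> {b, v} \<in> G" if "v \<in> V" for v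
    using assms(4-6) that by (force simp: complete_bipartite_def doubleton_eq_iff)
  then have "addable r n H G a b"
    unfolding addable_def using assms by (intro exI[of _ V]) (auto simp: link_def)
  with assms show ?thesis unfolding saturated_def by blast
qed

text \<open>Each cut is crossed by both graphs or by neither: one direction is the cut invariant,
  the other is saturation. The hypothesis \<open>sat\<close> makes the \<open>LEAST\<close> in
  \<open>final_graph\<close> a genuine stopping time.\<close>

lemma final_graph_connected_iff:
  assumes V: "V \<subseteq> {1..n}" "card V = r - 2"
    and sat: "\<exists>t. saturated r n H (triadic_graph r n V H s t)"
  shows "connected_on ({1..n} - V) (final_graph r n V H s) \<longleftrightarrow>
    connected_on ({1..n} - V) (link V H)"
proof -
  define W G where "W = {1..n} - V" and "G = final_graph r n V H s"
  have finV: "finite V" using V finite_subset by blast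
  have satG: "saturated r n H G" unfolding G_def final_graph_def using sat by (rule LeastI_ex)
  have bip: "complete_bipartite V ({1..n} - V) \<subseteq> G"
    unfolding G_def final_graph_def using triadic_graph_mono[of 0] by fastforce
  have "(\<exists>a\<in>S. \<exists>b\<in>W - S. {a, b} \<in> G) \<longleftrightarrow> (\<exists>a\<in>S. \<exists>b\<in>W - S. {a, b} \<in> link V H)" if S: "S \<subseteq> W" for S
  proof
    assume "\<exists>a\<in>S. \<exists>b\<in>W - S. {a, b} \<in> G"
    then show "\<exists>a\<in>S. \<exists>b\<in>W - S. {a, b} \<in> link V H"
      using triadic_graph_cut[OF finV V(2), of S n H] S
      unfolding W_def G_def final_graph_def by blast
  next
    assume "\<exists>a\<in>S. \<exists>b\<in>W - S. {a, b} \<in> link V H"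
    then obtain a b where ab: "a \<in> S" "b \<in> W - S" "{a, b} \<in> link V H" by blast
    then have "{a, b} \<in> G"
      using S by (intro saturated_imp_link_subset[OF satG V bip]) (auto simp: W_def)
    with ab show "\<exists>a\<in>S. \<exists>b\<in>W - S. {a, b} \<in> G" by blast
  qed
  then show ?thesis unfolding connected_on_iff_cut W_def[symmetric] G_def[symmetric]
    by (simp cong: imp_cong)
qed

section \<open>Almost sure termination of the process\<close>

text \<open>The graphs increase within a finite set of possible edges, so they are constant from
  some time \<open>T\<close> on. A pair addable at time \<open>T\<close> stays addable and is chosen
  again later, so its edge must be present already.\<close>

lemma saturated_eventually:
  assumes io: "\<And>x y T. x \<in> {1..n} \<Longrightarrow> y \<in> {1..n} \<Longrightarrow> x \<noteq> y \<Longrightarrow> \<exists>t\<ge>T. s !! t = (x, y)"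
  shows "\<exists>t. saturated r n H (triadic_graph r n V H s t)"
proof -
  define G where "G = triadic_graph r n V H s"
  \<comment> \<open>Intersecting with the finite set \<open>Pow {1..n}\<close> bounds the
    cardinality without an invariant saying where edges live.\<close>
  define c where "c t = card (G t \<inter> Pow {1..n})" for t
  have mono: "G t \<subseteq> G t'" if "t \<le> t'" for t t'
    using triadic_graph_mono[OF that] by (simp add: G_def)
  have "c t \<le> card (Pow {1..n})" for t unfolding c_def by (intro card_mono) auto
  then obtain T where T: "\<And>t. c t \<le> c T"
    using ex_has_greatest_nat[of "\<lambda>_. True" 0 c "Suc (card (Pow {1..n}))"] by (auto simp: le_imp_less_Suc)
  have const: "G t \<inter> Pow {1..n} = G T \<inter> Pow {1..n}" if "T \<le> t" for t
    by (rule sym, rule card_seteq) (use T[of t] mono[OF that] in \<open>auto simp: c_def\<close>)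
  have "{x, y} \<in> G T"
    if xy: "x \<in> {1..n}" "y \<in> {1..n}" "x \<noteq> y" and add: "addable r n H (G T) x y" for x y
  proof -
    obtain t where t: "t \<ge> T" "s !! t = (x, y)" using io xy by blast
    have "addable r n H (G t) x y" by (rule addable_mono[OF add mono[OF t(1)]])
    then have "{x, y} \<in> G (Suc t)" using t by (simp add: G_def)
    with const[of "Suc t"] t xy show ?thesis by auto
  qed
  then show ?thesis unfolding saturated_def G_def by blast
qed

text \<open>Let \<open>m\<close> be the probability that \<open>a\<close> never occurs. Conditioning
  on the first entry gives \<open>m = m * (1 - pmf M a)\<close>, which forces \<open>m = 0\<close>.
  Occurrence after time \<open>T\<close> then follows by induction, dropping the head of the
  stream.\<close>

lemma AE_stream_space_infinitely_often:
  fixes M :: "'a :: countable pmf"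
  assumes a: "a \<in> set_pmf M"
  shows "AE s in stream_space (measure_pmf M). \<forall>T. \<exists>i\<ge>T. s !! i = a"
proof -
  interpret S: prob_space "stream_space (measure_pmf M)"
    by (rule prob_space.prob_space_stream_space[OF prob_space_measure_pmf])
  let ?S = "stream_space (measure_pmf M)"
  define m where "m = \<P>(s in ?S. \<forall>i. s !! i \<noteq> a)"
  have [measurable]: "Measurable.pred ?S (\<lambda>s. \<forall>i. s !! i \<noteq> a)" by measurable
  have split: "(\<forall>i. (t ## s) !! i \<noteq> a) \<longleftrightarrow> t \<noteq> a \<and> (\<forall>i. s !! i \<noteq> a)" for t s
    by (auto simp: Stream_snth split: nat.splits)
  have "ennreal m = (\<integral>\<^sup>+t. ennreal (\<P>(s in ?S. \<forall>i. (t ## s) !! i \<noteq> a)) \<partial>measure_pmf M)"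
    unfolding m_def by (rule prob_space.prob_stream_space[OF prob_space_measure_pmf]) measurable
  also have "\<dots> = (\<integral>\<^sup>+t. ennreal m * indicator (- {a}) t \<partial>measure_pmf M)"
    by (intro nn_integral_cong) (auto simp: split m_def split: split_indicator)
  also have "\<dots> = ennreal m * emeasure (measure_pmf M) (- {a})"
    by (simp add: nn_integral_cmult_indicator)
  also have "\<dots> = ennreal (m * (1 - pmf M a))"
    by (simp add: measure_pmf.emeasure_eq_measure ennreal_mult m_def pmf_le_1
        measure_pmf.prob_compl[of "{a}", simplified, unfolded Compl_eq_Diff_UNIV[symmetric]]
        measure_pmf_single)
  finally have "m = m * (1 - pmf M a)"
    by (subst (asm) ennreal_inj) (auto simp: m_def pmf_le_1)
  moreover have "pmf M a > 0" using a by (simp add: pmf_positive)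
  ultimately have "m = 0" by (simp add: algebra_simps)
  then have ae0: "AE s in ?S. \<exists>i. s !! i = a"
    unfolding m_def by (subst (asm) S.prob_Collect_eq_0) auto
  have "AE s in ?S. \<exists>i\<ge>T. s !! i = a" for T
  proof (induction T)
    case 0
    then show ?case using ae0 by simp
  next
    case (Suc T)
    show ?case
    proof (subst prob_space.AE_stream_space[OF prob_space_measure_pmf])
      show "Measurable.pred ?S (\<lambda>s. \<exists>i\<ge>Suc T. s !! i = a)" by measurable
      have "AE s in ?S. \<exists>i\<ge>Suc T. (x ## s) !! i = a" for x
        using Suc by eventually_elim (metis Suc_le_mono snth.simps(2) stream.sel(2))
      then show "AE x in M. AE s in ?S. \<exists>i\<ge>Suc T. (x ## s) !! i = a" by simp
    qed
  qed
  then show ?thesis by (simp add: AE_all_countable)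
qed

text \<open>The exceptional null set, on which one of the finitely many pairs is chosen only
  finitely often, does not depend on \<open>H\<close>. For \<open>n \<ge> 2\<close> there is a pair
  to choose, so \<open>random_pair\<close> is a true uniform distribution.\<close>

lemma AE_saturated:
  assumes "n \<ge> 2"
  shows "AE s in stream_space (measure_pmf (random_pair n)).
    \<forall>H. \<exists>t. saturated r n H (triadic_graph r n V H s t)"
proof -
  let ?P = "{(x, y). x \<in> {1..n} \<and> y \<in> {1..n} \<and> x \<noteq> y}"
  have fin: "finite ?P" by (rule finite_subset[of _ "{1..n} \<times> {1..n}"]) auto
  have "(1, 2) \<in> ?P" using assms by auto
  then have ne: "?P \<noteq> {}" by blast
  have set: "set_pmf (random_pair n) = ?P"
    unfolding random_pair_def by (rule set_pmf_of_set[OF ne fin])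
  have "AE s in stream_space (measure_pmf (random_pair n)). \<forall>a\<in>?P. \<forall>T. \<exists>i\<ge>T. s !! i = a"
    using AE_stream_space_infinitely_often[of _ "random_pair n"] fin
    unfolding set by (intro AE_finite_allI) auto
  then show ?thesis
    by eventually_elim (intro allI saturated_eventually, auto)
qed

section \<open>Measurability and reduction to the link graph\<close>

text \<open>The graph at time \<open>t\<close> depends on \<open>s\<close> only through its first
  \<open>t\<close> entries, which form a list from a countable type. For a fixed list the predicate
  depends on \<open>H\<close> alone, whose sigma-algebra is discrete.\<close>

lemma pred_triadic_graph_measurable:
  "Measurable.pred (triadic_space r n p) (\<lambda>(H, s). P H (triadic_graph r n V H s t))"
proof -
  \<comment> \<open>The padding \<open>sconst (0, 0)\<close> is arbitrary: entries from position
    \<open>t\<close> on are never read.\<close>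
  define f where "f l x = P (fst x) (triadic_graph r n V (fst x) (l @- sconst (0, 0)) t)"
    for l and x :: "nat set set \<times> (nat \<times> nat) stream"
  have eq: "(\<lambda>(H, s). P H (triadic_graph r n V H s t)) = (\<lambda>x. f (stake t (snd x)) x)"
  proof (rule ext, clarify)
    fix H s
    have "triadic_graph r n V H s t = triadic_graph r n V H (stake t s @- sconst (0, 0)) t"
      by (rule triadic_graph_cong) (simp add: shift_snth_less)
    then show "P H (triadic_graph r n V H s t) = f (stake t (snd (H, s))) (H, s)"
      by (simp add: f_def)
  qed
  have [measurable_cong]: "sets (stream_space (measure_pmf (random_pair n))) =
      sets (stream_space (count_space UNIV))"
    by (rule sets_stream_space_cong) simp
  show ?thesis unfolding eq
  proof (rule measurable_compose_countable[where f = f and g = "\<lambda>x. stake t (snd x)"])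
    show "Measurable.pred (triadic_space r n p) (f l)" for l
      unfolding f_def triadic_space_def
      by (rule measurable_compose[OF measurable_fst]) simp
    show "(\<lambda>x. stake t (snd x)) \<in> triadic_space r n p \<rightarrow>\<^sub>M count_space UNIV"
      unfolding triadic_space_def by measurable
  qed
qed

text \<open>The event is split over the countably many values of the measurable stopping time
  \<open>g\<close>.\<close>

lemma pred_final_graph_measurable:
  "Measurable.pred (triadic_space r n p) (\<lambda>(H, s). P (final_graph r n V H s))"
proof -
  define f where "f t x = P (triadic_graph r n V (fst x) (snd x) t)"
    for t and x :: "nat set set \<times> (nat \<times> nat) stream"
  define g where "g x = (LEAST t. saturated r n (fst x) (triadic_graph r n V (fst x) (snd x) t))"
    for x :: "nat set set \<times> (nat \<times> nat) stream"
  have "Measurable.pred (triadic_space r n p) (\<lambda>x. f (g x) x)"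
  proof (rule measurable_compose_countable[where f = f and g = g])
    show "Measurable.pred (triadic_space r n p) (f t)" for t
      using pred_triadic_graph_measurable[where P = "\<lambda>_. P"]
      unfolding f_def case_prod_unfold .
    show "g \<in> triadic_space r n p \<rightarrow>\<^sub>M count_space UNIV"
      unfolding g_def
      by (rule measurable_Least)
        (rule pred_triadic_graph_measurable[where P = "saturated r n", unfolded case_prod_unfold])
  qed
  then show ?thesis by (simp add: f_def g_def final_graph_def case_prod_unfold)
qed

text \<open>For each fixed \<open>H\<close>, almost every \<open>s\<close> reaches saturation. By
  Fubini the event agrees almost everywhere with the cylinder \<open>C \<times> UNIV\<close>, whose
  measure is that of \<open>C\<close>.\<close>

lemma prob_final_connected_eq_link:
  assumes n: "n \<ge> 2" and V: "V \<subseteq> {1..n}" "card V = r - 2"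
  shows "prob_final_connected r n V p =
    measure_pmf.prob (random_hypergraph r n p) {H. connected_on ({1..n} - V) (link V H)}"
proof -
  let ?R = "measure_pmf (random_hypergraph r n p)"
  let ?S = "stream_space (measure_pmf (random_pair n))"
  interpret S: prob_space ?S by (rule prob_space.prob_space_stream_space[OF prob_space_measure_pmf])
  interpret P: pair_prob_space ?R ?S ..
  let ?M = "triadic_space r n p"
  define E where "E = {(H, s) \<in> space ?M. connected_on ({1..n} - V) (final_graph r n V H s)}"
  define C where "C = {H. connected_on ({1..n} - V) (link V H)}"
  have spS: "space ?S = UNIV" by (simp add: space_stream_space)
  have spM: "space ?M = UNIV" by (simp add: triadic_space_def space_pair_measure spS)
  have E: "E \<in> sets ?M"
    using pred_final_graph_measurable[where P = "connected_on ({1..n} - V)"]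
    unfolding E_def pred_def by (simp add: case_prod_unfold)
  have UC: "C \<times> UNIV \<in> sets ?M"
    using sets.top[of ?S] unfolding triadic_space_def spS by (intro pair_measureI) auto
  have "AE x in ?M. x \<in> E \<longleftrightarrow> x \<in> C \<times> UNIV"
    unfolding triadic_space_def
  proof (rule P.AE_pair_measure)
    have "{x \<in> space ?M. (x \<in> E) = (x \<in> C \<times> UNIV)} = (E \<inter> (C \<times> UNIV)) \<union> (space ?M - (E \<union> C \<times> UNIV))"
      unfolding spM by auto
    then show "{x \<in> space (?R \<Otimes>\<^sub>M ?S). (x \<in> E) = (x \<in> C \<times> UNIV)} \<in> sets (?R \<Otimes>\<^sub>M ?S)"
      using E UC unfolding triadic_space_def by simp
    have "AE s in ?S. ((H, s) \<in> E) = ((H, s) \<in> C \<times> UNIV)" for H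
      using AE_saturated[OF n, of r V]
      by eventually_elim (use final_graph_connected_iff[OF V] in \<open>simp add: E_def C_def spM\<close>)
    then show "AE H in ?R. AE s in ?S. ((H, s) \<in> E) = ((H, s) \<in> C \<times> UNIV)" by simp
  qed
  then have "measure ?M E = measure ?M (C \<times> UNIV)" using E UC by (rule measure_eq_AE)
  also have "\<dots> = measure ?R C"
    unfolding triadic_space_def
    using S.emeasure_pair_measure_Times[of C ?R UNIV] sets.top[of ?S] S.emeasure_space_1
    by (simp add: measure_def spS)
  finally show ?thesis unfolding prob_final_connected_def E_def C_def .
qed

subsection \<open>Connectedness of the random link graph\<close>

lemma finite_uniform_edges [simp]: "finite (uniform_edges r n)"
  by (rule finite_subset[of _ "Pow {1..n}"]) (auto simp: uniform_edges_def)

text \<open>Uncrossed cuts and isolated vertices are both events of this type. As a condition on the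
  indicator function it is a product set, so independence applies.\<close>

lemma prob_random_hypergraph_avoid:
  assumes A: "A \<subseteq> uniform_edges r n" and p: "0 \<le> p" "p \<le> 1"
  shows "measure_pmf.prob (random_hypergraph r n p) {H. A \<inter> H = {}} = (1 - p) ^ card A"
proof -
  let ?U = "uniform_edges r n"
  let ?B = "\<lambda>e. if e \<in> A then {False} else UNIV"
  have "measure_pmf.prob (random_hypergraph r n p) {H. A \<inter> H = {}} =
      measure_pmf.prob (Pi_pmf ?U False (\<lambda>_. bernoulli_pmf p)) (Pi ?U ?B)"
    unfolding random_hypergraph_def measure_map_pmf
    using A by (intro arg_cong[where f = "measure_pmf.prob _"]) (auto simp: Pi_def)
  also have "\<dots> = (\<Prod>e\<in>?U. if e \<in> A then 1 - p else 1)"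
    using p by (subst measure_Pi_pmf_Pi) (auto intro!: prod.cong simp: measure_pmf_single)
  also have "\<dots> = (\<Prod>e\<in>A. 1 - p)"
    using A by (simp add: prod.If_cases Int_absorb1)
  finally show ?thesis by simp
qed

text \<open>These are the \<open>r\<close>-sets whose absence from \<open>H\<close> means that no
  link edge joins \<open>S\<close> to \<open>T\<close>.\<close>

definition cone_edges :: "nat set \<Rightarrow> nat set \<Rightarrow> nat set \<Rightarrow> nat set set" where
  "cone_edges V S T = (\<lambda>(a, b). {a, b} \<union> V) ` (S \<times> T)"

lemma cone_edges_avoid_iff:
  "cone_edges V S T \<inter> H = {} \<longleftrightarrow> (\<forall>a\<in>S. \<forall>b\<in>T. {a, b} \<notin> link V H)"
  by (auto simp: cone_edges_def link_def)

lemma cone_inject: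
  assumes "e \<inter> V = {}" "e' \<inter> V = {}"
  shows "e \<union> V = e' \<union> V \<longleftrightarrow> e = e'"
  using assms by blast

text \<open>Since \<open>S\<close> and \<open>T\<close> are disjoint, the unordered pair
  \<open>{a, b}\<close> determines which element came from \<open>S\<close>, so no hyperedge is
  counted twice.\<close>

lemma card_cone_edges:
  assumes "S \<inter> T = {}" "S \<inter> V = {}" "T \<inter> V = {}"
  shows "card (cone_edges V S T) = card S * card T"
proof -
  have "inj_on (\<lambda>(a, b). {a, b} \<union> V) (S \<times> T)"
  proof (rule inj_onI, clarify)
    fix a b c d assume *: "a \<in> S" "b \<in> T" "c \<in> S" "d \<in> T" "{a, b} \<union> V = {c, d} \<union> V"
    then have "{a, b} = {c, d}"
      using assms by (subst (asm) cone_inject) blast+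
    then show "a = c \<and> b = d" using * assms(1) by (auto simp: doubleton_eq_iff)
  qed
  then show ?thesis unfolding cone_edges_def by (simp add: card_image card_cartesian_product)
qed

lemma cone_edges_uniform:
  assumes r: "r \<ge> 2" and V: "V \<subseteq> {1..n}" "card V = r - 2"
    and "S \<subseteq> {1..n} - V" "T \<subseteq> {1..n} - V" "S \<inter> T = {}"
  shows "cone_edges V S T \<subseteq> uniform_edges r n"
proof
  fix e assume "e \<in> cone_edges V S T"
  then obtain a b where ab: "a \<in> S" "b \<in> T" "e = {a, b} \<union> V"
    unfolding cone_edges_def by auto
  have "finite V" using V finite_subset by blast
  then have "card e = r"
    unfolding ab(3) using ab(1,2) assms by (subst card_Un_disjoint) (auto simp: card_insert_if)
  then show "e \<in> uniform_edges r n" using ab assms by (auto simp: uniform_edges_def)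
qed

lemma sum_power_card_Pow:
  fixes q :: real
  assumes "finite W"
  shows "(\<Sum>S\<in>Pow W. q ^ card S) = (1 + q) ^ card W"
  using prod_add[OF assms, of "\<lambda>_. q" "\<lambda>_. 1"] by (simp add: add.commute)

lemma one_minus_power_le_exp:
  fixes p :: real
  assumes "0 \<le> p" "p \<le> 1"
  shows "(1 - p) ^ m \<le> exp (- p * real m)"
proof -
  have "(1 - p) ^ m \<le> exp (- p) ^ m"
    using assms exp_ge_add_one_self[of "- p"] by (intro power_mono) auto
  then show ?thesis by (simp add: exp_of_nat_mult[symmetric] mult.commute)
qed

text \<open>A union bound over the smaller side \<open>S\<close> of an empty cut: the first term accounts for \<open>S\<close> with at
  most \<open>\<delta> N\<close> vertices, whose cut is empty with probability at most \<open>exp (- p (1 - \<delta>) N) ^ card S\<close>;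
  for the others the crude count \<open>2 ^ N\<close> suffices.\<close>

lemma prob_link_disconnected_le:
  fixes \<delta> p :: real
  assumes r: "r \<ge> 2" and V: "V \<subseteq> {1..n}" "card V = r - 2"
    and p: "0 \<le> p" "p \<le> 1" and \<delta>: "0 \<le> \<delta>" "\<delta> \<le> 1"
  defines "N \<equiv> card ({1..n} - V)"
  shows "measure_pmf.prob (random_hypergraph r n p) {H. \<not> connected_on ({1..n} - V) (link V H)}
    \<le> exp (real N * exp (- p * (1 - \<delta>) * real N)) - 1
      + 2 ^ N * exp (- p * \<delta> * (real N)\<^sup>2 / 2)"
proof -
  define W where "W = {1..n} - V"
  have finW: "finite W" and N: "card W = N" by (simp_all add: W_def N_def)
  let ?P = "measure_pmf.prob (random_hypergraph r n p)"
  define F where "F = {S \<in> Pow W - {{}}. 2 * card S \<le> N}"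
  define q where "q = exp (- p * (1 - \<delta>) * real N)"
  define Q where "Q = exp (- p * \<delta> * (real N)\<^sup>2 / 2)"
  have finF: "finite F" unfolding F_def using finW by simp
  have sub: "{H. \<not> connected_on W (link V H)} \<subseteq> (\<Union>S\<in>F. {H. cone_edges V S (W - S) \<inter> H = {}})"
  proof
    fix H assume "H \<in> {H. \<not> connected_on W (link V H)}"
    then obtain S where S: "S \<subseteq> W" "S \<noteq> {}" "S \<noteq> W"
      and no: "\<And>a b. a \<in> S \<Longrightarrow> b \<in> W - S \<Longrightarrow> {a, b} \<notin> link V H"
      by (auto simp: connected_on_iff_cut)
    show "H \<in> (\<Union>S\<in>F. {H. cone_edges V S (W - S) \<inter> H = {}})"
    proof (cases "2 * card S \<le> N")
      case True
      then show ?thesis using S no by (intro UN_I[of S]) (auto simp: F_def cone_edges_avoid_iff)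
    next
      \<comment> \<open>A cut is symmetric, so when \<open>S\<close> is the larger side its
        complement serves as the index in \<open>F\<close>.\<close>
      case False
      have "card (W - S) = N - card S"
        using S finW N by (subst card_Diff_subset) (auto intro: finite_subset)
      with False have "W - S \<in> F" using S by (auto simp: F_def)
      moreover have "W - (W - S) = S" using S by blast
      moreover have "{a, b} \<notin> link V H" if "a \<in> W - S" "b \<in> S" for a b
        using no[OF that(2,1)] by (simp add: insert_commute)
      ultimately show ?thesis by (intro UN_I[of "W - S"]) (auto simp: cone_edges_avoid_iff)
    qed
  qed
  have each: "?P {H. cone_edges V S (W - S) \<inter> H = {}} \<le> q ^ card S + Q" if "S \<in> F" for S
  proof -
    define k where "k = card S"
    from that have S: "S \<subseteq> W" "2 * k \<le> N" by (auto simp: F_def k_def)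
    have cardWS: "card (W - S) = N - k"
      using S finW N unfolding k_def by (subst card_Diff_subset) (auto intro: finite_subset)
    have "?P {H. cone_edges V S (W - S) \<inter> H = {}} = (1 - p) ^ card (cone_edges V S (W - S))"
      using S by (intro prob_random_hypergraph_avoid cone_edges_uniform r V p) (auto simp: W_def)
    also have "card (cone_edges V S (W - S)) = card S * card (W - S)"
      using S by (intro card_cone_edges) (auto simp: W_def)
    also have "\<dots> = k * (N - k)" by (simp add: cardWS k_def)
    also have "(1 - p) ^ (k * (N - k)) \<le> exp (- p * real (k * (N - k)))"
      by (rule one_minus_power_le_exp[OF p])
    also have "real (k * (N - k)) = real k * (real N - real k)"
      using S by (simp add: of_nat_diff)
    also have "exp (- p * (real k * (real N - real k))) \<le> q ^ k + Q"
    proof (cases "real k \<le> \<delta> * real N")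
      case True
      then have "real k * ((1 - \<delta>) * real N) \<le> real k * (real N - real k)"
        by (intro mult_left_mono) (auto simp: algebra_simps)
      then have "p * (real k * ((1 - \<delta>) * real N)) \<le> p * (real k * (real N - real k))"
        using p(1) by (rule mult_left_mono)
      then have "exp (- p * (real k * (real N - real k))) \<le> exp (real k * (- p * (1 - \<delta>) * real N))"
        by (simp add: algebra_simps)
      also have "\<dots> = q ^ k" unfolding q_def by (rule exp_of_nat_mult)
      finally show ?thesis by (simp add: Q_def add_increasing2)
    next
      case False
      \<comment> \<open>Here \<open>k > \<delta> N\<close>, while \<open>2 k \<le> N\<close> gives
        \<open>N - k \<ge> N / 2\<close>.\<close>
      have "\<delta> * real N * (real N / 2) \<le> real k * (real N - real k)"
        using False S \<delta> by (intro mult_mono) auto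
      then have "p * (\<delta> * real N * (real N / 2)) \<le> p * (real k * (real N - real k))"
        using p(1) by (rule mult_left_mono)
      then have "exp (- p * (real k * (real N - real k))) \<le> Q"
        unfolding Q_def by (simp add: algebra_simps power2_eq_square)
      then show ?thesis by (simp add: q_def add_increasing)
    qed
    finally show ?thesis by (simp add: k_def)
  qed
  have "?P {H. \<not> connected_on W (link V H)} \<le> ?P (\<Union>S\<in>F. {H. cone_edges V S (W - S) \<inter> H = {}})"
    by (rule measure_pmf.finite_measure_mono[OF sub]) simp
  also have "\<dots> \<le> (\<Sum>S\<in>F. ?P {H. cone_edges V S (W - S) \<inter> H = {}})"
    by (rule measure_pmf.finite_measure_subadditive_finite[OF finF]) auto
  also have "\<dots> \<le> (\<Sum>S\<in>F. q ^ card S + Q)" by (rule sum_mono[OF each])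
  \<comment> \<open>Dropping the size restriction makes the binomial theorem applicable; the removed
    empty set accounts for the \<open>- 1\<close> in the bound.\<close>
  also have "\<dots> \<le> (\<Sum>S\<in>Pow W - {{}}. q ^ card S + Q)"
    using finW by (intro sum_mono2) (auto simp: F_def q_def Q_def)
  also have "\<dots> = (\<Sum>S\<in>Pow W - {{}}. q ^ card S) + real (card (Pow W - {{}})) * Q"
    by (simp add: sum.distrib)
  also have "(\<Sum>S\<in>Pow W - {{}}. q ^ card S) = (1 + q) ^ N - 1"
    using finW sum_power_card_Pow[OF finW, of q] by (simp add: sum_diff1 N)
  also have "(1 + q) ^ N \<le> exp q ^ N"
    by (intro power_mono) (auto simp: q_def add_nonneg_nonneg)
  also have "exp q ^ N = exp (real N * q)" by (simp add: exp_of_nat_mult)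
  also have "real (card (Pow W - {{}})) \<le> 2 ^ N"
    using card_mono[of "Pow W" "Pow W - {{}}"] finW
    by (simp add: card_Pow N)
  finally show ?thesis by (simp add: W_def q_def Q_def mult_right_mono)
qed

section \<open>The second moment method for isolated vertices\<close>

text \<open>Chebyshev's argument: if \<open>X\<close> counts the events that occur and has mean
  \<open>\<mu>\<close>, then \<open>(X - \<mu>)\<^sup>2\<close> equals \<open>\<mu>\<^sup>2\<close>
  wherever none occurs. So \<open>\<mu>\<^sup>2\<close> times the probability in question is at most
  the variance of \<open>X\<close>.\<close>

lemma (in prob_space) second_moment_bound:
  fixes I :: "'i \<Rightarrow> 'a set"
  assumes W: "finite W" and I: "\<And>x. x \<in> W \<Longrightarrow> I x \<in> events"
    and pos: "(\<Sum>x\<in>W. prob (I x)) > 0"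
  shows "prob (space M - (\<Union>x\<in>W. I x)) \<le>
    (\<Sum>x\<in>W. \<Sum>y\<in>W. prob (I x \<inter> I y)) / (\<Sum>x\<in>W. prob (I x))\<^sup>2 - 1"
proof -
  define X where "X \<omega> = (\<Sum>x\<in>W. indicator (I x) \<omega> :: real)" for \<omega>
  define \<mu> where "\<mu> = (\<Sum>x\<in>W. prob (I x))"
  have int1 [simp]: "integrable M (indicator (I x) :: 'a \<Rightarrow> real)" if "x \<in> W" for x
    using I[OF that] by (intro integrable_real_indicator) (auto simp: less_top[symmetric])
  have X: "integrable M X" unfolding X_def by (intro Bochner_Integration.integrable_sum int1)
  have EX: "expectation X = \<mu>"
    unfolding X_def \<mu>_def using I by (subst Bochner_Integration.integral_sum) auto
  have X2: "(X \<omega>)\<^sup>2 = (\<Sum>x\<in>W. \<Sum>y\<in>W. indicator (I x \<inter> I y) \<omega>)" for \<omega>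
    by (simp add: X_def power2_eq_square sum_product indicator_inter_arith)
  have int2: "integrable M (indicator (I x \<inter> I y) :: 'a \<Rightarrow> real)" if "x \<in> W" "y \<in> W" for x y
    using I that by (intro integrable_real_indicator) (auto simp: less_top[symmetric])
  have iX2: "integrable M (\<lambda>\<omega>. (X \<omega>)\<^sup>2)" unfolding X2
    by (intro Bochner_Integration.integrable_sum int2)
  have EX2: "expectation (\<lambda>\<omega>. (X \<omega>)\<^sup>2) = (\<Sum>x\<in>W. \<Sum>y\<in>W. prob (I x \<inter> I y))"
  proof -
    have "expectation (\<lambda>\<omega>. (X \<omega>)\<^sup>2) =
        (\<Sum>x\<in>W. expectation (\<lambda>\<omega>. \<Sum>y\<in>W. indicator (I x \<inter> I y) \<omega>))"
      unfolding X2
      by (intro Bochner_Integration.integral_sum Bochner_Integration.integrable_sum int2)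
    also have "\<dots> = (\<Sum>x\<in>W. \<Sum>y\<in>W. expectation (indicator (I x \<inter> I y)))"
      by (intro sum.cong refl Bochner_Integration.integral_sum int2)
    also have "\<dots> = (\<Sum>x\<in>W. \<Sum>y\<in>W. prob (I x \<inter> I y))"
      using I by (intro sum.cong refl) (simp add: sets.Int)
    finally show ?thesis .
  qed
  define A where "A = space M - (\<Union>x\<in>W. I x)"
  have A: "A \<in> events" unfolding A_def using W I by auto
  have "\<mu>\<^sup>2 * prob A = expectation (\<lambda>\<omega>. \<mu>\<^sup>2 * indicator A \<omega>)" using A by simp
  also have "\<dots> \<le> expectation (\<lambda>\<omega>. (X \<omega>)\<^sup>2 + \<mu>\<^sup>2 - 2 * \<mu> * X \<omega>)"
  proof (rule integral_mono)
    show "integrable M (\<lambda>\<omega>. \<mu>\<^sup>2 * indicator A \<omega>)"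
      using A by (intro integrable_mult_right integrable_real_indicator) (auto simp: less_top[symmetric])
    show "integrable M (\<lambda>\<omega>. (X \<omega>)\<^sup>2 + \<mu>\<^sup>2 - 2 * \<mu> * X \<omega>)" using X iX2 by simp
    fix \<omega> assume "\<omega> \<in> space M"
    have "X \<omega> = 0" if "\<omega> \<in> A" using that unfolding X_def A_def by (intro sum.neutral) auto
    moreover have "(X \<omega>)\<^sup>2 + \<mu>\<^sup>2 - 2 * \<mu> * X \<omega> = (X \<omega> - \<mu>)\<^sup>2"
      by (simp add: power2_eq_square algebra_simps)
    ultimately show "\<mu>\<^sup>2 * indicator A \<omega> \<le> (X \<omega>)\<^sup>2 + \<mu>\<^sup>2 - 2 * \<mu> * X \<omega>"
      by (auto split: split_indicator)
  qed
  also have "\<dots> = expectation (\<lambda>\<omega>. (X \<omega>)\<^sup>2) - \<mu>\<^sup>2"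
    using X iX2 EX by (simp add: prob_space power2_eq_square)
  finally have "\<mu>\<^sup>2 * prob A \<le> (\<Sum>x\<in>W. \<Sum>y\<in>W. prob (I x \<inter> I y)) - \<mu>\<^sup>2" unfolding EX2 .
  then show ?thesis using pos unfolding A_def[symmetric] \<mu>_def[symmetric]
    by (simp add: field_simps)
qed

text \<open>Connectedness rules out isolated vertices of the link graph. Let \<open>I x\<close> be
  the event that \<open>x\<close> is isolated and \<open>\<mu>\<close> the expected number of
  isolated vertices. The events are nearly independent, so the second moment is at most
  \<open>\<mu> + \<mu>\<^sup>2 / (1 - p)\<close>.\<close>

lemma prob_link_connected_le:
  fixes p :: real
  assumes r: "r \<ge> 2" and V: "V \<subseteq> {1..n}" "card V = r - 2"
    and p: "0 \<le> p" "p < 1"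
  defines "N \<equiv> card ({1..n} - V)"
  assumes N2: "N \<ge> 2"
  shows "measure_pmf.prob (random_hypergraph r n p) {H. connected_on ({1..n} - V) (link V H)}
    \<le> 1 / (real N * (1 - p) ^ (N - 1)) + 1 / (1 - p) - 1"
proof -
  define W where "W = {1..n} - V"
  have finW: "finite W" and N: "card W = N" by (simp_all add: W_def N_def)
  let ?P = "measure_pmf.prob (random_hypergraph r n p)"
  define A where "A x = cone_edges V {x} (W - {x})" for x
  define I where "I x = {H. A x \<inter> H = {}}" for x
  have Aunif: "A x \<subseteq> uniform_edges r n" if "x \<in> W" for x
    unfolding A_def using that by (intro cone_edges_uniform r V) (auto simp: W_def)
  have cardA: "card (A x) = N - 1" if "x \<in> W" for x
    unfolding A_def using that finW N by (subst card_cone_edges) (auto simp: W_def)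
  have cardA2: "card (A x \<union> A y) = 2 * N - 3" if xy: "x \<in> W" "y \<in> W" "x \<noteq> y" for x y
  proof -
    \<comment> \<open>The only hyperedge relevant to both vertices is the one producing the edge
      \<open>{x, y}\<close>, hence the exponent \<open>2 * (N - 1) - 1\<close>.\<close>
    have "A x \<inter> A y = {{x, y} \<union> V}"
    proof (intro equalityI subsetI)
      fix e assume "e \<in> A x \<inter> A y"
      then obtain a b where ab: "a \<in> W - {x}" "b \<in> W - {y}" "e = {x, a} \<union> V" "e = {y, b} \<union> V"
        unfolding A_def cone_edges_def by auto
      then have "{x, a} = {y, b}"
        using xy cone_inject[of "{x, a}" V "{y, b}"] by (auto simp: W_def)
      with xy ab show "e \<in> {{x, y} \<union> V}" by (auto simp: doubleton_eq_iff)
    next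
      fix e assume "e \<in> {{x, y} \<union> V}"
      with xy show "e \<in> A x \<inter> A y" unfolding A_def cone_edges_def
        by (auto simp: image_iff insert_commute)
    qed
    moreover have "finite (A x)" "finite (A y)" 
      using finite_subset[OF Aunif] xy by simp_all
    ultimately have "card (A x) + card (A y) = card (A x \<union> A y) + 1"
      using card_Un_Int[of "A x" "A y"] by simp
    then show ?thesis using cardA xy by simp
  qed
  have PI: "?P (I x) = (1 - p) ^ (N - 1)" if "x \<in> W" for x
    unfolding I_def cardA[OF that, symmetric] using p Aunif[OF that]
    by (intro prob_random_hypergraph_avoid) auto
  have PI2: "?P (I x \<inter> I y) = (1 - p) ^ (2 * N - 3)" if "x \<in> W" "y \<in> W" "x \<noteq> y" for x y
  proof -
    have "I x \<inter> I y = {H. (A x \<union> A y) \<inter> H = {}}" unfolding I_def by blast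
    then show ?thesis unfolding cardA2[OF that, symmetric] using p Aunif that
      by (simp only:) (intro prob_random_hypergraph_avoid, auto)
  qed
  define u where "u = (1 - p) ^ (N - 1)"
  define \<mu> where "\<mu> = real N * u"
  have u: "u > 0" using p by (simp add: u_def)
  then have \<mu>: "\<mu> > 0" using N2 by (simp add: \<mu>_def)
  have sum1: "(\<Sum>x\<in>W. ?P (I x)) = \<mu>" by (simp add: PI N \<mu>_def u_def)
  \<comment> \<open>The shared hyperedge costs a factor \<open>1 / (1 - p)\<close> compared with
    independence.\<close>
  have pw: "(1 - p) ^ (2 * N - 3) = u\<^sup>2 / (1 - p)"
  proof -
    have "(1 - p) ^ (2 * N - 3) * (1 - p) = (1 - p) ^ Suc (2 * N - 3)" by simp
    also have "Suc (2 * N - 3) = (N - 1) + (N - 1)" using N2 by simp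
    also have "(1 - p) ^ ((N - 1) + (N - 1)) = u\<^sup>2" by (simp add: u_def power_add power2_eq_square)
    finally show ?thesis using p by (simp add: field_simps)
  qed
  have "(\<Sum>y\<in>W. ?P (I x \<inter> I y)) \<le> u + real N * (u\<^sup>2 / (1 - p))" if "x \<in> W" for x
  proof -
    have "(\<Sum>y\<in>W. ?P (I x \<inter> I y)) = ?P (I x) + (\<Sum>y\<in>W - {x}. ?P (I x \<inter> I y))"
      using finW that by (subst sum.remove) auto
    also have "(\<Sum>y\<in>W - {x}. ?P (I x \<inter> I y)) = (\<Sum>y\<in>W - {x}. u\<^sup>2 / (1 - p))"
      using that by (intro sum.cong) (auto simp: PI2 pw)
    also have "\<dots> \<le> (\<Sum>y\<in>W. u\<^sup>2 / (1 - p))"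
      using finW p by (intro sum_mono2) auto
    finally show ?thesis using that by (simp add: PI u_def N)
  qed
  then have "(\<Sum>x\<in>W. \<Sum>y\<in>W. ?P (I x \<inter> I y)) \<le> (\<Sum>x\<in>W. u + real N * (u\<^sup>2 / (1 - p)))"
    by (rule sum_mono)
  also have "\<dots> = \<mu> + \<mu>\<^sup>2 / (1 - p)" by (simp add: N \<mu>_def algebra_simps power2_eq_square)
  finally have sum2: "(\<Sum>x\<in>W. \<Sum>y\<in>W. ?P (I x \<inter> I y)) \<le> \<mu> + \<mu>\<^sup>2 / (1 - p)" .
  have "{H. connected_on W (link V H)} \<subseteq> UNIV - (\<Union>x\<in>W. I x)"
  proof (rule subsetI, rule ccontr)
    fix H assume "H \<in> {H. connected_on W (link V H)}" "H \<notin> UNIV - (\<Union>x\<in>W. I x)"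
    then obtain x where conn: "connected_on W (link V H)" and x: "x \<in> W" "H \<in> I x" by auto
    \<comment> \<open>With at least two vertices, an isolated \<open>x\<close> yields a proper cut
      \<open>{x}\<close>.\<close>
    have "{x} \<noteq> W" using N N2 by auto
    with conn x obtain b where "b \<in> W - {x}" "{x, b} \<in> link V H"
      unfolding connected_on_iff_cut by (metis empty_subsetI insert_not_empty insert_subset singletonD)
    with x show False by (auto simp: I_def A_def cone_edges_avoid_iff)
  qed
  then have "?P {H. connected_on W (link V H)} \<le> ?P (UNIV - (\<Union>x\<in>W. I x))"
    by (rule measure_pmf.finite_measure_mono) simp
  also have "\<dots> \<le> (\<Sum>x\<in>W. \<Sum>y\<in>W. ?P (I x \<inter> I y)) / \<mu>\<^sup>2 - 1"
    using measure_pmf.second_moment_bound[OF finW, of I "random_hypergraph r n p"] \<mu> sum1 by simp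
  also have "\<dots> \<le> (\<mu> + \<mu>\<^sup>2 / (1 - p)) / \<mu>\<^sup>2 - 1"
    using sum2 by (intro diff_right_mono divide_right_mono) auto
  also have "\<dots> = 1 / \<mu> + 1 / (1 - p) - 1"
    using \<mu> by (simp add: add_divide_distrib power2_eq_square)
  finally show ?thesis by (simp add: W_def \<mu>_def u_def)
qed

subsection \<open>The threshold\<close>

text \<open>With \<open>c = r - 2\<close>, the inner expression factors as
  \<open>(n - c) / n\<close>, the power \<open>n powr (1 - b)\<close> and
  \<open>exp (b * c * ln n / n)\<close>, with limits 1, 0 and 1.\<close>

lemma tendsto_0_small_cuts:
  fixes b c :: real
  assumes "1 < b"
  shows "(\<lambda>n. exp ((real n - c) * exp (- (b * ln (real n) / real n) * (real n - c))) - 1) \<longlonglongrightarrow> 0"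
proof -
  define \<epsilon> where "\<epsilon> = b - 1"
  have \<epsilon>: "\<epsilon> > 0" using assms by (simp add: \<epsilon>_def)
  have "(\<lambda>n. (real n - c) / real n) \<longlonglongrightarrow> 1" by real_asymp
  moreover have "(\<lambda>n. exp (- \<epsilon> * ln (real n))) \<longlonglongrightarrow> 0" using \<epsilon> by real_asymp
  moreover have "(\<lambda>n. exp (b * c * (ln (real n) / real n))) \<longlonglongrightarrow> exp (b * c * 0)"
    by real_asymp
  ultimately have "(\<lambda>n. (real n - c) / real n * exp (- \<epsilon> * ln (real n)) *
      exp (b * c * (ln (real n) / real n))) \<longlonglongrightarrow> 1 * 0 * exp (b * c * 0)"
    by (intro tendsto_mult)
  moreover have "\<forall>\<^sub>F n in sequentially. (real n - c) / real n * exp (- \<epsilon> * ln (real n)) *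
      exp (b * c * (ln (real n) / real n)) =
      (real n - c) * exp (- (b * ln (real n) / real n) * (real n - c))"
    using eventually_gt_at_top[of 0]
  proof eventually_elim
    case (elim n)
    have "- (b * ln (real n) / real n) * (real n - c) =
        - ln (real n) + - \<epsilon> * ln (real n) + b * c * (ln (real n) / real n)"
      using elim by (simp add: field_simps \<epsilon>_def)
    then show ?case using elim by (simp only: exp_add) (simp add: exp_minus field_simps)
  qed
  ultimately have "(\<lambda>n. (real n - c) * exp (- (b * ln (real n) / real n) * (real n - c))) \<longlonglongrightarrow> 0"
    by (simp add: tendsto_cong)
  then have "(\<lambda>n. exp ((real n - c) * exp (- (b * ln (real n) / real n) * (real n - c))) - 1)
      \<longlonglongrightarrow> exp 0 - 1"
    by (intro tendsto_intros)
  then show ?thesis by simp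
qed

text \<open>The negative exponent has order \<open>n * ln n\<close> and beats the factor
  \<open>2 powr (n - c)\<close>.\<close>

lemma tendsto_0_large_cuts:
  fixes b c \<delta> :: real
  assumes "0 < b" "0 < \<delta>"
  shows "(\<lambda>n. 2 powr (real n - c) * exp (- (b * ln (real n) / real n) * \<delta> * (real n - c)\<^sup>2 / 2)) \<longlonglongrightarrow> 0"
  using assms by real_asymp

text \<open>This is the expected number of isolated vertices at \<open>p = a * ln n / n\<close>.
  Since \<open>(n - c - 1) * ln (1 - p) = - a * ln n + o(1)\<close>, it is asymptotic to
  \<open>n powr (1 - a)\<close>.\<close>

lemma first_moment_at_top:
  fixes a c :: real
  assumes "0 < a" "a < 1"
  shows "filterlim (\<lambda>n. (real n - c) * (1 - a * ln (real n) / real n) powr (real n - c - 1)) at_top sequentially"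
proof -
  define \<epsilon> where "\<epsilon> = 1 - a"
  have \<epsilon>: "\<epsilon> > 0" using assms by (simp add: \<epsilon>_def)
  have l1: "(\<lambda>n. (real n - c) / real n) \<longlonglongrightarrow> 1" by real_asymp
  have l2: "filterlim (\<lambda>n. exp (\<epsilon> * ln (real n))) at_top sequentially" using \<epsilon> by real_asymp
  have "(\<lambda>n. (real n - c - 1) * ln (1 - a * ln (real n) / real n) + a * ln (real n)) \<longlonglongrightarrow> 0"
    using assms(1) by real_asymp
  then have "(\<lambda>n. exp ((real n - c - 1) * ln (1 - a * ln (real n) / real n) + a * ln (real n))) \<longlonglongrightarrow> exp 0"
    by (intro tendsto_intros)
  from tendsto_mult[OF l1 this] have "(\<lambda>n. (real n - c) / real n *
      exp ((real n - c - 1) * ln (1 - a * ln (real n) / real n) + a * ln (real n))) \<longlonglongrightarrow> 1"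
    by simp
  from filterlim_tendsto_pos_mult_at_top[OF this _ l2]
  have "filterlim (\<lambda>n. (real n - c) / real n *
      exp ((real n - c - 1) * ln (1 - a * ln (real n) / real n) + a * ln (real n)) *
      exp (\<epsilon> * ln (real n))) at_top sequentially" by simp
  moreover have "\<forall>\<^sub>F n in sequentially. (real n - c) / real n *
      exp ((real n - c - 1) * ln (1 - a * ln (real n) / real n) + a * ln (real n)) *
      exp (\<epsilon> * ln (real n)) =
    (real n - c) * (1 - a * ln (real n) / real n) powr (real n - c - 1)"
  proof -
    have "\<forall>\<^sub>F n in sequentially. 1 - a * ln (real n) / real n > 0" by real_asymp
    with eventually_gt_at_top[of 0] show ?thesis
    proof eventually_elim
      case (elim n)
      have "exp (a * ln (real n)) * exp (\<epsilon> * ln (real n)) = real n"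
        using elim by (simp add: exp_add[symmetric] \<epsilon>_def algebra_simps)
      then show ?case using elim by (simp add: exp_add powr_def mult.assoc)
    qed
  qed
  ultimately show ?thesis by (simp cong: filterlim_cong)
qed

lemma ln_over_self_nonneg: "0 \<le> ln (real n) / real n"
  by (cases "n = 0") auto

theorem theorem1p3:
  fixes r :: nat and V :: "nat \<Rightarrow> nat set"
  assumes "r \<ge> 3"
    and "\<And>n. n \<ge> r - 2 \<Longrightarrow> V n \<subseteq> {1..n} \<and> card (V n) = r - 2"
  shows "is_threshold (\<lambda>n p. prob_final_connected r n (V n) p) (\<lambda>n. ln (real n) / real n)"
  unfolding is_threshold_def
proof (intro allI impI conjI)
  fix p :: "nat \<Rightarrow> real" and \<epsilon> :: real
  assume p: "\<forall>n. 0 \<le> p n \<and> p n \<le> 1" and \<epsilon>: "\<epsilon> > 0"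
  define c where "c = real (r - 2)"
  let ?Q = "\<lambda>n. prob_final_connected r n (V n) (p n)"
  \<comment> \<open>From \<open>n \<ge> r\<close> on, at least two vertices remain after deleting
    \<open>V n\<close>.\<close>
  have large: "\<forall>\<^sub>F n in sequentially. n \<ge> r"
    by (rule eventually_ge_at_top)
  have V: "V n \<subseteq> {1..n}" "card (V n) = r - 2" if "n \<ge> r" for n
    using assms(2)[of n] that by auto
  have N: "card ({1..n} - V n) = n - (r - 2)" if "n \<ge> r" for n
    using V[OF that] by (subst card_Diff_subset) (auto intro: finite_subset)
  have Q: "?Q n = measure_pmf.prob (random_hypergraph r n (p n)) {H. connected_on ({1..n} - V n) (link (V n) H)}"
    if "n \<ge> r" for n
    using that assms(1) V by (intro prob_final_connected_eq_link) auto
  have cN: "real (n - (r - 2)) = real n - c" if "n \<ge> r" for n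
    using that by (simp add: c_def of_nat_diff)
  {
    assume ev: "\<forall>\<^sub>F n in sequentially. p n \<ge> (1 + \<epsilon>) * (ln (real n) / real n)"
    \<comment> \<open>This choice gives
      \<open>(1 + \<epsilon>) * (1 - \<delta>) = 1 + \<epsilon> / 2\<close>, so the small cuts stay
      above the threshold.\<close>
    define \<delta> where "\<delta> = \<epsilon> / (2 * (1 + \<epsilon>))"
    define p0 where "p0 n = (1 + \<epsilon>) * ln (real n) / real n" for n
    have \<delta>: "0 < \<delta>" "\<delta> < 1" using \<epsilon> by (auto simp: \<delta>_def field_simps)
    have b: "(1 + \<epsilon>) * (1 - \<delta>) = 1 + \<epsilon> / 2" using \<epsilon> by (simp add: \<delta>_def field_simps)
    define B where "B n = exp ((real n - c) * exp (- ((1 + \<epsilon> / 2) * ln (real n) / real n) * (real n - c))) - 1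
      + 2 powr (real n - c) * exp (- ((1 + \<epsilon>) * ln (real n) / real n) * \<delta> * (real n - c)\<^sup>2 / 2)" for n
    have "B \<longlonglongrightarrow> 0 + 0" unfolding B_def
      using \<epsilon> \<delta> by (intro tendsto_add tendsto_0_small_cuts tendsto_0_large_cuts) auto
    then have B: "(\<lambda>n. 1 - B n) \<longlonglongrightarrow> 1" by (auto intro!: tendsto_eq_intros)
    have lower: "\<forall>\<^sub>F n in sequentially. 1 - B n \<le> ?Q n"
      using ev large
    proof eventually_elim
      case (elim n)
      let ?R = "random_hypergraph r n (p n)" and ?W = "{1..n} - V n"
      have pp: "p0 n \<le> p n" using elim by (simp add: p0_def)
      have "1 - ?Q n = measure_pmf.prob ?R {H. \<not> connected_on ?W (link (V n) H)}"
        unfolding Q[OF elim(2)]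
        using measure_pmf.prob_compl[of "{H. connected_on ?W (link (V n) H)}" ?R]
        by (simp add: Collect_neg_eq Compl_eq_Diff_UNIV)
      also have "\<dots> \<le> exp ((real n - c) * exp (- p n * (1 - \<delta>) * (real n - c))) - 1
          + 2 ^ (n - (r - 2)) * exp (- p n * \<delta> * (real n - c)\<^sup>2 / 2)"
        using prob_link_disconnected_le[of r "V n" n "p n" \<delta>, unfolded N[OF elim(2)] cN[OF elim(2)]]
          assms(1) V[OF elim(2)] p \<delta> by simp
      \<comment> \<open>The bound decreases in the edge probability, so \<open>p n\<close> may be
        replaced by the explicit \<open>p0 n\<close>.\<close>
      also have "\<dots> \<le> exp ((real n - c) * exp (- p0 n * (1 - \<delta>) * (real n - c))) - 1
          + 2 ^ (n - (r - 2)) * exp (- p0 n * \<delta> * (real n - c)\<^sup>2 / 2)"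
        using pp \<delta> cN[OF elim(2), symmetric]
        by (intro add_mono diff_right_mono mult_left_mono iffD2[OF exp_le_cancel_iff]
            divide_right_mono mult_right_mono) auto
      also have "- p0 n * (1 - \<delta>) = - ((1 + \<epsilon> / 2) * ln (real n) / real n)"
        unfolding b[symmetric] p0_def by simp
      also have "(2::real) ^ (n - (r - 2)) = 2 powr (real n - c)"
        by (simp add: powr_realpow[symmetric] cN[OF elim(2)])
      finally show ?case unfolding B_def p0_def by simp
    qed
    have upper: "\<forall>\<^sub>F n in sequentially. ?Q n \<le> 1"
      using large by eventually_elim (simp add: Q)
    show "?Q \<longlonglongrightarrow> 1"
      by (rule tendsto_sandwich[OF lower upper B tendsto_const])
  next
    assume ev: "\<forall>\<^sub>F n in sequentially. p n \<le> (1 - \<epsilon>) * (ln (real n) / real n)"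
    \<comment> \<open>For \<open>\<epsilon> \<ge> 1\<close> the factor \<open>1 - \<epsilon>\<close>
      is not positive; the maximum keeps \<open>a\<close> strictly between 0 and 1 and only weakens
      the upper bound on \<open>p n\<close>.\<close>
    define a where "a = max (1 - \<epsilon>) (1 / 2)"
    define p0 where "p0 n = a * ln (real n) / real n" for n
    have a: "0 < a" "a < 1" using \<epsilon> by (auto simp: a_def)
    define B where "B n = 1 / ((real n - c) * (1 - p0 n) powr (real n - c - 1)) + 1 / (1 - p0 n) - 1" for n
    have "(\<lambda>n. 1 / ((real n - c) * (1 - p0 n) powr (real n - c - 1))) \<longlonglongrightarrow> 0"
      unfolding p0_def
      by (rule tendsto_divide_0[OF tendsto_const filterlim_at_top_imp_at_infinity[OF first_moment_at_top[OF a]]])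
    moreover have "(\<lambda>n. 1 / (1 - p0 n)) \<longlonglongrightarrow> 1" unfolding p0_def by real_asymp
    ultimately have "B \<longlonglongrightarrow> 0 + 1 - 1" unfolding B_def by (intro tendsto_intros)
    then have B: "B \<longlonglongrightarrow> 0" by simp
    have "\<forall>\<^sub>F n in sequentially. p0 n < 1" unfolding p0_def by real_asymp
    with ev large have upper: "\<forall>\<^sub>F n in sequentially. ?Q n \<le> B n"
    proof eventually_elim
      case (elim n)
      define m where "m = n - (r - 2)"
      have m: "m \<ge> 2" "real m = real n - c" using elim assms(1) cN by (auto simp: m_def)
      have "(1 - \<epsilon>) * (ln (real n) / real n) \<le> a * (ln (real n) / real n)"
        by (intro mult_right_mono ln_over_self_nonneg) (simp add: a_def)
      with elim have pp: "p n \<le> p0 n" by (simp add: p0_def)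
      have "?Q n \<le> 1 / (real m * (1 - p n) ^ (m - 1)) + 1 / (1 - p n) - 1"
        using prob_link_connected_le[of r "V n" n "p n", unfolded N[OF elim(2)], folded m_def]
          elim(3) pp p m(1) assms(1) V[OF elim(2)] by (simp add: Q[OF elim(2)])
      \<comment> \<open>This bound increases in the edge probability, so
        \<open>p n \<le> p0 n\<close> suffices; \<open>p0 n < 1\<close> keeps the denominators
        positive.\<close>
      also have "\<dots> \<le> 1 / (real m * (1 - p0 n) ^ (m - 1)) + 1 / (1 - p0 n) - 1"
        using elim pp m p
        by (intro add_mono diff_right_mono divide_left_mono mult_left_mono power_mono mult_pos_pos
            zero_less_power) auto
      also have "(1 - p0 n) ^ (m - 1) = (1 - p0 n) powr (real n - c - 1)"
        using elim m by (simp add: powr_realpow[symmetric] of_nat_diff)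
      finally show ?case by (simp add: B_def m)
    qed
    have lower: "\<forall>\<^sub>F n in sequentially. 0 \<le> ?Q n"
      using large by eventually_elim (simp add: Q)
    show "?Q \<longlonglongrightarrow> 0"
      by (rule tendsto_sandwich[OF lower upper tendsto_const B])
  }
qed

end
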